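(* Let $n \ge 4$ be an even integer and let $G$ be a finite solvable group whose character degree graph $\Delta(G)$ has exactly $n$ vertices and is $(n-2)$-regular. Then the characteristic polynomial of the Laplacian matrix of $\Delta(G)$ is $$x\,(x-(n-2))^{\frac{n}{2}}\,(x-n)^{\frac{n}{2}-1}.$$
   Context: For a finite group $G$, $\mathrm{Irr}(G)$ is the set of complex irreducible characters of $G$, $\mathrm{cd}(G)=\{\chi(1) : \chi\in \mathrm{Irr}(G)\}$, and $\rho(G)$ is the set of primes dividing some element of $\mathrm{cd}(G)$. The character degree graph $\Delta(G)$ is the simple undirected graph with vertex set $\rho(G)$ in which distinct primes $p,q$ are adjacent if and only if $pq$ divides some $r\in \mathrm{cd}(G)$. For a finite simple graph $\Gamma$, the Laplacian matrix is $L(\Gamma)=D(\Gamma)-A(\Gamma)$, where $D(\Gamma)$ is the diagonal matrix of vertex degrees and $A(\Gamma)$ is the adjacency matrix. The characteristic polynomial of an $n\times n$ matrix $M$ is taken to be the monic polynomial $\det(xI-M)$. *)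

theory Defs
  imports
    "HOL-Algebra.Solvable_Groups"
    "HOL-Computational_Algebra.Primes"
    "Jordan_Normal_Form.Char_Poly"
    "Jordan_Normal_Form.VS_Connect"
    "Graph_Theory.Pair_Digraph"
begin

text \<open>The group \<open>GL\<^sub>d(\<complex>)\<close>, as the unit group of the ring of \<open>d \<times> d\<close> matrices.\<close>

definition GL :: "nat \<Rightarrow> complex mat monoid" where
  "GL d = units_of (ring_mat TYPE(complex) d ())"

definition invariant_subspace ::
  "('g, 'b) monoid_scheme \<Rightarrow> nat \<Rightarrow> ('g \<Rightarrow> complex mat) \<Rightarrow> complex vec set \<Rightarrow> bool" where
  "invariant_subspace G d \<rho> W \<longleftrightarrow>
     subspace class_ring W (module_vec TYPE(complex) d) \<and>
     (\<forall>g\<in>carrier G. \<forall>w\<in>W. \<rho> g *\<^sub>v w \<in> W)"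

text \<open>The zero representation (\<open>d = 0\<close>) does not count as irreducible.\<close>

definition irreducible_rep ::
  "('g, 'b) monoid_scheme \<Rightarrow> nat \<Rightarrow> ('g \<Rightarrow> complex mat) \<Rightarrow> bool" where
  "irreducible_rep G d \<rho> \<longleftrightarrow>
     d > 0 \<and> \<rho> \<in> hom G (GL d) \<and>
     (\<forall>W. invariant_subspace G d \<rho> W \<longrightarrow> W = {0\<^sub>v d} \<or> W = carrier_vec d)"

definition mat_trace :: "'a :: comm_monoid_add mat \<Rightarrow> 'a" where
  "mat_trace A = (\<Sum>i<dim_row A. A $$ (i, i))"

text \<open>Characters are restricted to \<^term>\<open>carrier G\<close>, so that equality of functions
  is equality of characters.\<close>

definition rep_character ::
  "('g, 'b) monoid_scheme \<Rightarrow> ('g \<Rightarrow> complex mat) \<Rightarrow> 'g \<Rightarrow> complex" where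
  "rep_character G \<rho> = (\<lambda>g\<in>carrier G. mat_trace (\<rho> g))"

definition Irr :: "('g, 'b) monoid_scheme \<Rightarrow> ('g \<Rightarrow> complex) set" where
  "Irr G = {rep_character G \<rho> | \<rho> d. irreducible_rep G d \<rho>}"

text \<open>The values \<open>\<chi>(1)\<close> are complex numbers that happen to be natural; see
  \<open>cd_eq_irreducible_dims\<close> below.\<close>

definition cd :: "('g, 'b) monoid_scheme \<Rightarrow> nat set" where
  "cd G = {m. \<exists>\<chi>\<in>Irr G. \<chi> \<one>\<^bsub>G\<^esub> = of_nat m}"

definition degree_primes :: "('g, 'b) monoid_scheme \<Rightarrow> nat set" where
  "degree_primes G = {p. prime p \<and> (\<exists>m\<in>cd G. p dvd m)}"

text \<open>An undirected graph is represented by its symmetric arc relation, as in the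
  locales \<^locale>\<open>pair_bidirected_digraph\<close> and \<^locale>\<open>pair_graph\<close>.\<close>

definition character_degree_graph :: "('g, 'b) monoid_scheme \<Rightarrow> nat pair_pre_digraph" where
  "character_degree_graph G =
     \<lparr>pverts = degree_primes G,
      parcs = {(p, q). p \<in> degree_primes G \<and> q \<in> degree_primes G \<and> p \<noteq> q \<and>
                       (\<exists>r\<in>cd G. p * q dvd r)}\<rparr>"

text \<open>In a symmetric digraph without parallel arcs, the out-degree of a vertex is its number
  of neighbours.\<close>

abbreviation vertex_degree :: "'a pair_pre_digraph \<Rightarrow> 'a \<Rightarrow> nat" where
  "vertex_degree \<Gamma> v \<equiv> out_degree (with_proj \<Gamma>) v"

definition regular_graph :: "nat \<Rightarrow> 'a pair_pre_digraph \<Rightarrow> bool" where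
  "regular_graph k \<Gamma> \<longleftrightarrow> (\<forall>v\<in>pverts \<Gamma>. vertex_degree \<Gamma> v = k)"

text \<open>Rows and columns are indexed by the vertices in increasing order; the
  characteristic polynomial does not depend on the enumeration chosen.\<close>

definition vertex_enum :: "'a :: linorder pair_pre_digraph \<Rightarrow> nat \<Rightarrow> 'a" where
  "vertex_enum \<Gamma> i = sorted_list_of_set (pverts \<Gamma>) ! i"

definition degree_matrix :: "'a :: linorder pair_pre_digraph \<Rightarrow> real mat" where
  "degree_matrix \<Gamma> = mat_diag (card (pverts \<Gamma>))
     (\<lambda>i. real (vertex_degree \<Gamma> (vertex_enum \<Gamma> i)))"

definition adjacency_matrix :: "'a :: linorder pair_pre_digraph \<Rightarrow> real mat" where
  "adjacency_matrix \<Gamma> = mat (card (pverts \<Gamma>)) (card (pverts \<Gamma>))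
     (\<lambda>(i, j). if (vertex_enum \<Gamma> i, vertex_enum \<Gamma> j) \<in> parcs \<Gamma> then 1 else 0)"

definition laplacian_matrix :: "'a :: linorder pair_pre_digraph \<Rightarrow> real mat" where
  "laplacian_matrix \<Gamma> = degree_matrix \<Gamma> - adjacency_matrix \<Gamma>"

lemma GL_simps:
  "carrier (GL d) = Units (ring_mat TYPE(complex) d ())"
  "x \<otimes>\<^bsub>GL d\<^esub> y = x * y"
  "\<one>\<^bsub>GL d\<^esub> = 1\<^sub>m d"
  by (simp_all add: GL_def units_of_def ring_mat_simps)

lemma group_GL: "group (GL d)"
proof -
  interpret semiring "ring_mat TYPE(complex) d ()" by (rule semiring_mat)
  show ?thesis unfolding GL_def by (rule units_group)
qed

lemma rep_character_one:
  assumes "group G" "\<rho> \<in> hom G (GL d)"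
  shows "rep_character G \<rho> \<one>\<^bsub>G\<^esub> = of_nat d"
proof -
  interpret group_hom G "GL d" \<rho>
    using assms group_GL by (simp add: group_hom_def group_hom_axioms_def)
  have "\<rho> \<one>\<^bsub>G\<^esub> = 1\<^sub>m d" by (simp add: GL_simps(3))
  then show ?thesis by (simp add: rep_character_def mat_trace_def)
qed

lemma cd_eq_irreducible_dims:
  assumes "group G"
  shows "cd G = {d. \<exists>\<rho>. irreducible_rep G d \<rho>}"
proof -
  have one: "rep_character G \<rho> \<one>\<^bsub>G\<^esub> = of_nat d" if "irreducible_rep G d \<rho>" for d \<rho>
    using that rep_character_one[OF assms] by (simp add: irreducible_rep_def)
  show ?thesis
    unfolding cd_def Irr_def using one by (fastforce simp del: of_nat_eq_iff dest: of_nat_eq_iff[THEN iffD1])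
qed

lemma pair_bidirected_character_degree_graph:
  "pair_bidirected_digraph (character_degree_graph G)"
  by unfold_locales
    (auto simp: character_degree_graph_def symmetric_def mult.commute intro!: symI)

lemma pair_graph_character_degree_graph:
  assumes "finite (degree_primes G)"
  shows "pair_graph (character_degree_graph G)"
proof -
  interpret pair_bidirected_digraph "character_degree_graph G"
    by (rule pair_bidirected_character_degree_graph)
  have "parcs (character_degree_graph G) \<subseteq> degree_primes G \<times> degree_primes G"
    by (auto simp: character_degree_graph_def)
  then have "finite (parcs (character_degree_graph G))"
    using assms by (meson finite_SigmaI finite_subset)
  then show ?thesis
    using assms by unfold_locales (simp_all add: character_degree_graph_def)
qed

end

theory Submission
  imports Defs "Jordan_Normal_Form.Schur_Decomposition"
begin

text \<open>An \<open>(n-2)\<close>-regular graph on \<open>n\<close> vertices is the complement of a perfect matching, that is,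
  of a fixed-point-free involution \<open>\<tau>\<close>, and its Laplacian \<open>L\<close> acts by
  \<open>(L v)\<^sub>i = (n-1) v\<^sub>i + v\<^sub>\<tau>\<^sub>i - \<Sum>\<^sub>j v\<^sub>j\<close>. If \<open>L v = k v\<close> with \<open>k \<noteq> 0\<close>, then summing over
  \<open>i\<close> gives \<open>\<Sum>\<^sub>j v\<^sub>j = 0\<close>, and applying the relation at \<open>i\<close> and at \<open>\<tau> i\<close> gives \<open>(k-n+1)\<^sup>2 = 1\<close>.
  So the eigenvalues lie in \<open>{0, n-2, n}\<close>, and their multiplicities are determined by the
  size of the matrix and the traces of \<open>L\<close> and \<open>L\<^sup>2\<close>. The group enters only
  through its graph.\<close>

section \<open>Traces as power sums of the roots of the characteristic polynomial\<close>

lemma mat_trace_mult_comm: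
  fixes A B :: "'a :: comm_semiring_0 mat"
  assumes "A \<in> carrier_mat n m" "B \<in> carrier_mat m n"
  shows "mat_trace (A * B) = mat_trace (B * A)"
proof -
  have "mat_trace (A * B) = (\<Sum>i<n. \<Sum>j<m. A $$ (i, j) * B $$ (j, i))"
    using assms by (auto simp: mat_trace_def scalar_prod_def atLeast0LessThan intro!: sum.cong)
  also have "\<dots> = (\<Sum>j<m. \<Sum>i<n. B $$ (j, i) * A $$ (i, j))"
    by (subst sum.swap) (simp add: mult.commute)
  also have "\<dots> = mat_trace (B * A)"
    using assms by (auto simp: mat_trace_def scalar_prod_def atLeast0LessThan intro!: sum.cong)
  finally show ?thesis .
qed

lemma mat_trace_similar:
  fixes A B :: "'a :: comm_ring_1 mat"
  assumes "similar_mat A B"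
  shows "mat_trace A = mat_trace B"
proof -
  obtain n P Q where c: "{A, B, P, Q} \<subseteq> carrier_mat n n"
    and QP: "Q * P = 1\<^sub>m n" and A: "A = P * B * Q"
    using similar_matD[OF assms] by blast
  have "mat_trace A = mat_trace (Q * (P * B))"
    unfolding A using c by (intro mat_trace_mult_comm[of _ n n]) auto
  also have "Q * (P * B) = B"
    using c QP left_mult_one_mat[of B n n] by (simp flip: assoc_mult_mat[of Q n n P n B n])
  finally show ?thesis .
qed

lemma similar_mat_square:
  fixes A B :: "'a :: comm_ring_1 mat"
  assumes "similar_mat A B"
  shows "similar_mat (A * A) (B * B)"
proof -
  obtain P Q where w: "similar_mat_wit A B P Q"
    using assms unfolding similar_mat_def by blast
  then have c: "A \<in> carrier_mat (dim_row A) (dim_row A)" "B \<in> carrier_mat (dim_row A) (dim_row A)"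
    using similar_mat_witD(4,5)[OF refl w] by blast+
  have "A ^\<^sub>m 2 = A * A" "B ^\<^sub>m 2 = B * B"
    using left_mult_one_mat[OF c(1)] left_mult_one_mat[OF c(2)] carrier_matD[OF c(2)]
    by (simp_all add: numeral_2_eq_2)
  with similar_mat_wit_pow[OF w, of 2] show ?thesis
    unfolding similar_mat_def by metis
qed

text \<open>By Schur decomposition \<open>A\<close> is similar to an upper triangular
  \<open>B\<close>, and \<open>as\<close> is the diagonal of \<open>B\<close>. The diagonal of
  \<open>B * B\<close> consists of the squares of these entries, and traces are invariant under
  similarity.\<close>

lemma char_poly_roots_power_sums:
  fixes A :: "complex mat"
  assumes A: "A \<in> carrier_mat n n"
  obtains as where "char_poly A = (\<Prod>a\<leftarrow>as. [:- a, 1:])" "length as = n"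
    "mat_trace A = sum_list as" "mat_trace (A * A) = (\<Sum>a\<leftarrow>as. a\<^sup>2)"
proof -
  obtain B where B: "B \<in> carrier_mat n n" and ut: "upper_triangular B" and sim: "similar_mat A B"
    using char_poly_factorized[OF A] schur_decomposition_exists[OF A] by blast
  have diag: "diag_mat B = map (\<lambda>i. B $$ (i, i)) [0..<n]"
    using B by (simp add: diag_mat_def)
  have BB: "(B * B) $$ (i, i) = (B $$ (i, i))\<^sup>2" if i: "i < n" for i
  proof -
    have "(B * B) $$ (i, i) = (\<Sum>j\<in>{0..<n}. B $$ (i, j) * B $$ (j, i))"
      using B i by (auto simp: scalar_prod_def intro!: sum.cong)
    \<comment> \<open>For \<open>j \<noteq> i\<close> one of the two factors lies below the
      diagonal.\<close>
    also have "\<dots> = (\<Sum>j\<in>{i}. B $$ (i, j) * B $$ (j, i))"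
    proof (rule sum.mono_neutral_right)
      show "\<forall>j\<in>{0..<n} - {i}. B $$ (i, j) * B $$ (j, i) = 0"
      proof
        fix j assume "j \<in> {0..<n} - {i}"
        then consider "j < i" | "i < j" "j < n" by force
        then show "B $$ (i, j) * B $$ (j, i) = 0"
          using upper_triangularD[OF ut] B i by cases auto
      qed
    qed (use i in auto)
    finally show ?thesis by (simp add: power2_eq_square)
  qed
  show ?thesis
  proof (rule that[of "diag_mat B"])
    show "char_poly A = (\<Prod>a\<leftarrow>diag_mat B. [:- a, 1:])"
      using char_poly_similar[OF sim] char_poly_upper_triangular[OF B ut] by simp
    show "length (diag_mat B) = n" by (simp add: diag)
    show "mat_trace A = sum_list (diag_mat B)"
      unfolding mat_trace_similar[OF sim]
      using B by (simp add: mat_trace_def diag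
          interv_sum_list_conv_sum_set_nat atLeast0LessThan)
    show "mat_trace (A * A) = (\<Sum>a\<leftarrow>diag_mat B. a\<^sup>2)"
      unfolding mat_trace_similar[OF similar_mat_square[OF sim]]
      using B BB by (simp add: mat_trace_def diag
          interv_sum_list_conv_sum_set_nat atLeast0LessThan o_def)
  qed
qed

text \<open>Here \<open>a\<close>, \<open>b\<close>, \<open>c\<close> count the entries assigned to
  \<open>0\<close>, \<open>r\<close>, \<open>s\<close>. Asserting only their existence avoids
  assuming that these values are distinct.\<close>

lemma list_three_values:
  fixes as :: "'a :: comm_semiring_1 list" and f :: "'a \<Rightarrow> 'b :: comm_monoid_mult"
  assumes "set as \<subseteq> {0, r, s}"
  shows "\<exists>a b c. (\<Prod>t\<leftarrow>as. f t) = f 0 ^ a * f r ^ b * f s ^ c \<and>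
    length as = a + b + c \<and> sum_list as = of_nat b * r + of_nat c * s \<and>
    (\<Sum>t\<leftarrow>as. t\<^sup>2) = of_nat b * r\<^sup>2 + of_nat c * s\<^sup>2"
  using assms
proof (induction as)
  case Nil
  show ?case by (intro exI[of _ 0]) simp
next
  case (Cons t as)
  then obtain a b c where IH:
    "(\<Prod>t\<leftarrow>as. f t) = f 0 ^ a * f r ^ b * f s ^ c"
    "length as = a + b + c" "sum_list as = of_nat b * r + of_nat c * s"
    "(\<Sum>t\<leftarrow>as. t\<^sup>2) = of_nat b * r\<^sup>2 + of_nat c * s\<^sup>2" by auto
  from Cons.prems consider "t = 0" | "t = r" | "t = s" by auto
  then show ?case
  proof cases
    case 1
    show ?thesis
      by (rule exI[of _ "Suc a"], rule exI[of _ b], rule exI[of _ c])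
        (simp add: 1 IH mult_ac)
  next
    case 2
    show ?thesis
      by (rule exI[of _ a], rule exI[of _ "Suc b"], rule exI[of _ c])
        (simp add: 2 IH distrib_left distrib_right ac_simps)
  next
    case 3
    show ?thesis
      by (rule exI[of _ a], rule exI[of _ b], rule exI[of _ "Suc c"])
        (simp add: 3 IH distrib_left distrib_right ac_simps)
  qed
qed

section \<open>Spectrum of the Laplacian of the complement of a perfect matching\<close>

text \<open>The entry type is left open because the graph Laplacian is real, whereas its roots are
  found over the complex numbers.\<close>

definition matching_complement_laplacian :: "nat \<Rightarrow> (nat \<Rightarrow> nat) \<Rightarrow> 'a :: comm_ring_1 mat" where
  "matching_complement_laplacian n \<tau> = mat n n
     (\<lambda>(i, j). if i = j then of_nat n - 2 else if j = \<tau> i then 0 else - 1)"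

context
  fixes n :: nat and \<tau> :: "nat \<Rightarrow> nat"
  assumes less: "\<And>i. i < n \<Longrightarrow> \<tau> i < n"
    and neq: "\<And>i. i < n \<Longrightarrow> \<tau> i \<noteq> i"
    and invol: "\<And>i. i < n \<Longrightarrow> \<tau> (\<tau> i) = i"
begin

abbreviation (input) L where "L \<equiv> matching_complement_laplacian n \<tau>"

lemma L_carrier: "L \<in> carrier_mat n n"
  by (simp add: matching_complement_laplacian_def)

text \<open>This is \<open>(n - 1) I + P - J\<close>, with \<open>P\<close> the permutation matrix
  of \<open>\<tau>\<close> and \<open>J\<close> the all-ones matrix, so that matrix-vector sums
  split.\<close>

lemma L_index:
  "i < n \<Longrightarrow> j < n \<Longrightarrow>
    L $$ (i, j) = (of_nat n - 1) * of_bool (j = i) + of_bool (j = \<tau> i) - 1"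
  using neq[of i] by (auto simp: matching_complement_laplacian_def)

lemma sum_involution: "(\<Sum>i<n. f (\<tau> i)) = (\<Sum>i<n. f i)"
  by (rule sum.reindex_bij_witness[of _ \<tau> \<tau>]) (auto simp: less invol)

lemma L_eigenvalues:
  fixes k :: "'a :: field"
  assumes "eigenvalue L k"
  shows "k \<in> {0, of_nat n - 2, of_nat n}"
proof -
  obtain v where v: "v \<in> carrier_vec n" "v \<noteq> 0\<^sub>v n" "L *\<^sub>v v = k \<cdot>\<^sub>v v"
    using assms unfolding eigenvalue_def eigenvector_def carrier_matD(1)[OF L_carrier] by blast
  define S where "S = (\<Sum>j<n. v $ j)"
  have ev: "k * v $ i = (of_nat n - 1) * v $ i + v $ \<tau> i - S" if i: "i < n" for i
  proof -
    have "k * v $ i = (L *\<^sub>v v) $ i"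
      using v i by simp
    also have "\<dots> = (\<Sum>j<n. L $$ (i, j) * v $ j)"
      using v(1) i
      by (auto simp: carrier_matD[OF L_carrier] scalar_prod_def atLeast0LessThan intro!: sum.cong)
    also have "\<dots> = (\<Sum>j<n. (if j = i then (of_nat n - 1) * v $ j else 0)
        + (if j = \<tau> i then v $ j else 0) - v $ j)"
      using i by (intro sum.cong) (auto simp: L_index algebra_simps)
    also have "\<dots> = (of_nat n - 1) * v $ i + v $ \<tau> i - S"
      using i less[OF i] by (simp add: sum.distrib sum_subtractf S_def)
    finally show ?thesis .
  qed
  have "k * S = (\<Sum>i<n. (of_nat n - 1) * v $ i + v $ \<tau> i - S)"
    unfolding S_def sum_distrib_left by (rule sum.cong) (auto simp: ev S_def)
  \<comment> \<open>The three sums are \<open>(n - 1) S\<close>, \<open>S\<close> and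
    \<open>n S\<close>.\<close>
  also have "\<dots> = 0"
    by (simp add: sum.distrib sum_subtractf sum_involution flip: sum_distrib_left S_def)
      (simp add: algebra_simps)
  finally have "k = 0 \<or> S = 0" by simp
  moreover have "k \<in> {of_nat n - 2, of_nat n}" if S: "S = 0"
  proof -
    obtain i where i: "i < n" "v $ i \<noteq> 0"
      using v(1,2) by (metis carrier_vecD eq_vecI index_zero_vec)
    \<comment> \<open>When \<open>S = 0\<close>, the relation \<open>ev\<close> says that swapping
      coordinates along \<open>\<tau>\<close> multiplies \<open>v\<close> by \<open>?m\<close>.
      Swapping twice is the identity.\<close>
    let ?m = "k - of_nat n + 1"
    have "v $ \<tau> i = ?m * v $ i" "v $ i = ?m * v $ \<tau> i"
      using ev[OF i(1)] ev[OF less[OF i(1)]] invol[OF i(1)] S by (simp_all add: algebra_simps)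
    then have "v $ i = ?m * (?m * v $ i)" by simp
    then have "(?m * ?m - 1) * v $ i = 0" by (simp add: algebra_simps)
    then have "?m * ?m - 1 = 0"
      using i(2) by (simp only: mult_eq_0_iff simp_thms)
    then have "(?m - 1) * (?m + 1) = 0"
      by (simp add: algebra_simps)
    then have "?m = 1 \<or> ?m = - 1"
      by (simp only: mult_eq_0_iff eq_neg_iff_add_eq_0 right_minus_eq)
    moreover have "k = ?m + of_nat n - 1" by simp
    ultimately have "k = 1 + of_nat n - 1 \<or> k = - 1 + of_nat n - 1" by metis
    then show ?thesis by auto
  qed
  ultimately show ?thesis by auto
qed

lemma L_trace: "mat_trace L = of_nat n * (of_nat n - 2)"
  by (simp add: mat_trace_def matching_complement_laplacian_def)

text \<open>As \<open>\<tau>\<close> is an involution, the matrix is symmetric and the trace is the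
  sum of the squared entries. Each row contributes \<open>(n - 2)^2\<close> from the diagonal and
  \<open>1\<close> from each of \<open>n - 2\<close> neighbours.\<close>

lemma L_square_trace: "mat_trace (L * L) = of_nat n * (of_nat n - 1) * (of_nat n - 2)"
proof -
  have sq: "L $$ (i, j) * L $$ (j, i) =
      (if j = i then (of_nat n - 2)\<^sup>2 - 1 else 0) - (if j = \<tau> i then 1 else 0) + (1 :: 'a)"
    if "i < n" "j < n" for i j
    using that neq[of i] neq[of j] invol[of i] invol[of j]
    by (auto simp: matching_complement_laplacian_def power2_eq_square)
  have "mat_trace (L * L) = (\<Sum>i<n. \<Sum>j<n. L $$ (i, j) * L $$ (j, i) :: 'a)"
    by (auto simp: carrier_matD[OF L_carrier] mat_trace_def scalar_prod_def atLeast0LessThan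
        intro!: sum.cong)
  also have "\<dots> = (\<Sum>i<n. (of_nat n - 2)\<^sup>2 - 1 - 1 + of_nat n)"
    by (intro sum.cong refl) (simp add: sq less sum.distrib sum_subtractf)
  also have "\<dots> = of_nat n * (of_nat n - 1) * (of_nat n - 2)"
    by (simp add: power2_eq_square algebra_simps)
  finally show ?thesis .
qed

lemma complex_char_poly_L:
  assumes n: "n > 2"
  shows "char_poly (L :: complex mat) =
    [:0, 1:] * [:- (of_nat n - 2), 1:] ^ (n div 2) * [:- of_nat n, 1:] ^ (n div 2 - 1)"
proof -
  obtain as where as: "char_poly (L :: complex mat) = (\<Prod>a\<leftarrow>as. [:- a, 1:])" "length as = n"
    and tr: "mat_trace L = sum_list as" "mat_trace (L * L) = (\<Sum>a\<leftarrow>as. a\<^sup>2)"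
    using char_poly_roots_power_sums[OF L_carrier] .
  have "set as \<subseteq> {0, of_nat n - 2, of_nat n}"
  proof
    fix a assume "a \<in> set as"
    then have "poly (char_poly L) a = 0"
      unfolding as(1) poly_prod_list prod_list_zero_iff by force
    then show "a \<in> {0, of_nat n - 2, of_nat n}"
      using L_eigenvalues eigenvalue_root_char_poly[OF L_carrier] by blast
  qed
  \<comment> \<open>The multiplicities satisfy three linear equations: matrix size, trace, and trace
    of the square.\<close>
  from list_three_values[OF this, of "\<lambda>t. [:- t, 1:]"] obtain a b c where abc:
    "char_poly L = [:- 0, 1:] ^ a * [:- (of_nat n - 2), 1:] ^ b * [:- of_nat n :: complex, 1:] ^ c"
    "n = a + b + c"
    "of_nat n * (of_nat n - 2) = of_nat b * (of_nat n - 2) + of_nat c * (of_nat n :: complex)"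
    "of_nat n * (of_nat n - 1) * (of_nat n - 2) =
      of_nat b * (of_nat n - 2)\<^sup>2 + of_nat c * (of_nat n :: complex)\<^sup>2"
    unfolding as(1)[symmetric] as(2) tr(1)[symmetric] tr(2)[symmetric] L_trace L_square_trace by blast
  define N :: complex where "N = of_nat n"
  have N: "N \<noteq> 0" "N - 2 \<noteq> 0"
    using n by (auto simp: N_def dest: of_nat_eq_iff[of n 2, THEN iffD1, unfolded of_nat_numeral])
  have "(2 * of_nat b - N) * (N - 2) = 0"
  proof -
    \<comment> \<open>Subtracting the square-trace equation from \<open>N\<close> times the trace
      equation eliminates \<open>c\<close>. The factor \<open>N - 2\<close> then cancels because
      \<open>n > 2\<close>.\<close>
    have "(2 * of_nat b - N) * (N - 2) =
        N * (of_nat b * (N - 2) + of_nat c * N) - (of_nat b * (N - 2)\<^sup>2 + of_nat c * N\<^sup>2)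
        - (N * (N * (N - 2)) - N * (N - 1) * (N - 2))"
      by (simp add: power2_eq_square algebra_simps)
    then show ?thesis
      using abc(3,4) unfolding N_def[symmetric] by simp
  qed
  then have b: "of_nat (2 * b) = (of_nat n :: complex)"
    using N by (simp add: N_def)
  have "(2 * of_nat c - (N - 2)) * N = 0"
  proof -
    \<comment> \<open>Twice the trace equation, with \<open>2 b = N\<close> substituted.\<close>
    have "(2 * of_nat c - (N - 2)) * N =
        2 * (of_nat b * (N - 2) + of_nat c * N) - 2 * (N * (N - 2)) + (N - of_nat (2 * b)) * (N - 2)"
      by (simp add: algebra_simps)
    then show ?thesis
      using abc(3) b unfolding N_def[symmetric] by simp
  qed
  with N(1) have "2 * of_nat c - (N - 2) = 0"
    by (metis mult_eq_0_iff)
  \<comment> \<open>Moving the \<open>2\<close> to the left avoids truncated subtraction when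
    returning to the natural numbers.\<close>
  then have "of_nat (2 * c + 2) = (of_nat n :: complex)"
    by (simp add: N_def algebra_simps)
  with b have "2 * b = n" "2 * c + 2 = n"
    unfolding of_nat_eq_iff by simp_all
  with abc(2) have "a = 1" "b = n div 2" "c = n div 2 - 1" by auto
  then show ?thesis by (simp only: abc(1) power_one_right minus_zero)
qed

text \<open>The complex result descends along the injective map \<open>complex_of_real\<close>,
  which sends the real matrix to the complex one since all entries are images of integers.\<close>

lemma char_poly_L:
  assumes n: "n > 2"
  shows "char_poly (L :: real mat) =
    [:0, 1:] * [:- (of_nat n - 2), 1:] ^ (n div 2) * [:- of_nat n, 1:] ^ (n div 2 - 1)"
proof -
  interpret p: map_poly_inj_comm_ring_hom complex_of_real ..
  have "char_poly (map_mat complex_of_real L) = map_poly complex_of_real (char_poly L)"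
    by (rule of_real_hom.char_poly_hom[OF L_carrier])
  moreover have "map_mat complex_of_real L = L"
    by (auto simp: matching_complement_laplacian_def)
  ultimately have "map_poly complex_of_real (char_poly L) = char_poly L"
    by simp
  also have "\<dots> = map_poly complex_of_real
    ([:0, 1:] * [:- (of_nat n - 2), 1:] ^ (n div 2) * [:- of_nat n, 1:] ^ (n div 2 - 1))"
    unfolding complex_char_poly_L[OF n] p.hom_mult p.hom_power by simp
  finally show ?thesis by (simp only: p.eq_iff)
qed

end

section \<open>From a regular graph to its complementary matching\<close>

text \<open>Each vertex is adjacent to all but one of the other \<open>n - 1\<close> vertices.
  Sending an index to that of its unique non-neighbour gives \<open>\<tau>\<close>, an involution
  because adjacency is symmetric.\<close>

lemma laplacian_matrix_co_one_regular:
  fixes \<Gamma> :: "'a :: linorder pair_pre_digraph"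
  assumes "pair_graph \<Gamma>" and n: "card (pverts \<Gamma>) = n" "n \<ge> 2" and reg: "regular_graph (n - 2) \<Gamma>"
  obtains \<tau> where "\<And>i. i < n \<Longrightarrow> \<tau> i < n" "\<And>i. i < n \<Longrightarrow> \<tau> i \<noteq> i"
    "\<And>i. i < n \<Longrightarrow> \<tau> (\<tau> i) = i" "laplacian_matrix \<Gamma> = matching_complement_laplacian n \<tau>"
proof -
  interpret pair_graph \<Gamma> by fact
  define e where "e = vertex_enum \<Gamma>"
  have fin: "finite (pverts \<Gamma>)" by simp
  have loop: "(v, v) \<notin> parcs \<Gamma>" for v by (auto dest: no_loops)
  have bij: "bij_betw e {..<n} (pverts \<Gamma>)"
    unfolding e_def vertex_enum_def
    using bij_betw_nth[of "sorted_list_of_set (pverts \<Gamma>)"] fin n by simp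
  define M where "M i = {j\<in>{..<n}. j \<noteq> i \<and> (e i, e j) \<notin> parcs \<Gamma>}" for i
  have deg: "vertex_degree \<Gamma> (e i) = n - 2" if "i < n" for i
    using reg bij that by (auto simp: regular_graph_def bij_betw_def)
  have "card (M i) = 1" if i: "i < n" for i
  proof -
    let ?N = "{j\<in>{..<n}. (e i, e j) \<in> parcs \<Gamma>}"
    \<comment> \<open>The degree counts arcs; this turns it into a count of neighbouring
      indices.\<close>
    have "bij_betw (\<lambda>j. (e i, e j)) ?N (out_arcs \<Gamma> (e i))"
      unfolding bij_betw_def
    proof
      show "inj_on (\<lambda>j. (e i, e j)) ?N"
        using bij by (auto simp: inj_on_def bij_betw_def)
      show "(\<lambda>j. (e i, e j)) ` ?N = out_arcs \<Gamma> (e i)"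
      proof (intro equalityI subsetI)
        fix a assume "a \<in> out_arcs \<Gamma> (e i)"
        then obtain w where w: "a = (e i, w)" "(e i, w) \<in> parcs \<Gamma>"
          by (cases a) (auto simp: out_arcs_def)
        then have "w \<in> e ` {..<n}"
          using bij in_arcsD2[of "e i" w] by (simp add: bij_betw_def)
        then show "a \<in> (\<lambda>j. (e i, e j)) ` ?N" using w by auto
      qed (auto simp: out_arcs_def)
    qed
    then have "card ?N = n - 2"
      using deg[OF i] by (simp add: out_degree_def bij_betw_same_card)
    \<comment> \<open>The \<open>Suc\<close> accounts for \<open>i\<close> itself, which is outside
      \<open>?N\<close> because there are no loops.\<close>
    moreover have "n = Suc (card ?N + card (M i))"
    proof -
      have "{..<n} = insert i (?N \<union> M i)" "i \<notin> ?N \<union> M i"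
        using i loop[of "e i"] by (auto simp: M_def)
      moreover have fin: "finite ?N" "finite (M i)"
        by (simp_all add: M_def)
      ultimately have "card {..<n} = Suc (card (?N \<union> M i))"
        by (metis card_insert_disjoint finite_UnI)
      also have "card (?N \<union> M i) = card ?N + card (M i)"
        using fin by (intro card_Un_disjoint) (auto simp: M_def)
      finally show ?thesis by simp
    qed
    ultimately show ?thesis using n(2) by linarith
  qed
  then have "\<forall>i\<in>{..<n}. \<exists>j. M i = {j}" by (auto simp: card_1_singleton_iff)
  then obtain \<tau> where \<tau>: "\<And>i. i < n \<Longrightarrow> M i = {\<tau> i}" by (metis lessThan_iff)
  have less: "\<tau> i < n" and neq: "\<tau> i \<noteq> i" and nadj: "(e i, e (\<tau> i)) \<notin> parcs \<Gamma>" if "i < n" for i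
    using \<tau>[OF that] unfolding M_def by auto
  have adj: "(e i, e j) \<in> parcs \<Gamma> \<longleftrightarrow> j \<noteq> i \<and> j \<noteq> \<tau> i" if "i < n" "j < n" for i j
    using \<tau>[OF that(1)] that loop[of "e i"] unfolding M_def by blast
  have invol: "\<tau> (\<tau> i) = i" if "i < n" for i
  proof -
    \<comment> \<open>By symmetry \<open>i\<close> is a non-neighbour of \<open>\<tau> i\<close>,
      hence its only one.\<close>
    have "(e (\<tau> i), e i) \<notin> parcs \<Gamma>"
      using nadj[OF that] arcs_symmetric[of "e (\<tau> i)" "e i"] by blast
    then show ?thesis
      using adj[OF less[OF that] that] neq[OF that] by auto
  qed
  have "laplacian_matrix \<Gamma> = matching_complement_laplacian n \<tau>"
  proof (rule eq_matI)
    fix i j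
    assume "i < dim_row (matching_complement_laplacian n \<tau> :: real mat)"
      and "j < dim_col (matching_complement_laplacian n \<tau> :: real mat)"
    then have ij: "i < n" "j < n"
      by (simp_all add: matching_complement_laplacian_def)
    then show "laplacian_matrix \<Gamma> $$ (i, j) = matching_complement_laplacian n \<tau> $$ (i, j)"
      using n(2) deg[OF ij(1)] deg[OF ij(2)] adj[OF ij]
      by (simp add: laplacian_matrix_def degree_matrix_def adjacency_matrix_def n(1) mat_diag_def
          matching_complement_laplacian_def flip: e_def)
  qed (simp_all add: laplacian_matrix_def degree_matrix_def adjacency_matrix_def n(1) mat_diag_def
      matching_complement_laplacian_def)
  with less neq invol show ?thesis by (rule that)
qed

theorem theorem3p3:
  fixes G :: "('g, 'b) monoid_scheme" and n :: nat
  assumes "n \<ge> 4" and "even n"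
    and "group G" and "finite (carrier G)" and "solvable G"
    and "card (pverts (character_degree_graph G)) = n"
    and "regular_graph (n - 2) (character_degree_graph G)"
  shows "char_poly (laplacian_matrix (character_degree_graph G)) =
    [:0, 1:] * [:- real (n - 2), 1:] ^ (n div 2) * [:- real n, 1:] ^ (n div 2 - 1)"
proof -
  \<comment> \<open>\<^const>\<open>card\<close> vanishes on infinite sets.\<close>
  have "finite (degree_primes G)"
    using assms(1,6) by (intro card_ge_0_finite) (simp add: character_degree_graph_def)
  then have "pair_graph (character_degree_graph G)"
    by (rule pair_graph_character_degree_graph)
  then obtain \<tau> where "\<And>i. i < n \<Longrightarrow> \<tau> i < n" "\<And>i. i < n \<Longrightarrow> \<tau> i \<noteq> i"
    "\<And>i. i < n \<Longrightarrow> \<tau> (\<tau> i) = i"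
    "laplacian_matrix (character_degree_graph G) = matching_complement_laplacian n \<tau>"
    using laplacian_matrix_co_one_regular[OF _ assms(6) _ assms(7)] assms(1) by auto
  then show ?thesis
    \<comment> \<open>Since \<open>n \<ge> 4\<close>, the subtraction in \<open>real (n - 2)\<close>
      is not truncated.\<close>
    using char_poly_L[of n \<tau>] assms(1) by (simp only: of_nat_diff) simp
qed

end
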